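(* Let $\{e_n\}_{n=1}^{\infty}$ be a Riesz basis of a complex Hilbert space $H$, let $k\in\mathbb{N}$, let $\{f(n)\}_{n=1}^\infty\in\mathcal{S}_k$, and let $A_k$ be the operator on the Hilbert space $H_k(\{e_n\})$ given by $A_k\,(\mathfrak{f})\sum_{n=1}^{\infty}c_ne_n=(\mathfrak{f})\sum_{n=1}^{\infty}if(n)\,c_ne_n$ with domain $D(A_k)=\left\{x=(\mathfrak{f})\sum_{n=1}^{\infty}c_ne_n\in H_k(\{e_n\}):\ \{f(n)c_n\}_{n=1}^\infty\in\ell_2(\Delta^k)\right\}$. Then: (i) $\sigma(A_k)=\sigma_p(A_k)=\{if(n)\}_{n=1}^{\infty}$, where $\sigma$ denotes the spectrum and $\sigma_p$ the point spectrum (set of eigenvalues). (ii) For every $\lambda\in\rho(A_k)=\mathbb{C}\setminus\{if(n)\}_{n=1}^{\infty}$ and every $x=(\mathfrak{f})\sum_{n=1}^{\infty}c_ne_n\in H_k(\{e_n\})$, $$(A_k-\lambda I)^{-1}x=(\mathfrak{f})\sum_{n=1}^{\infty}\frac{c_n e_n}{if(n)-\lambda}.$$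
   Context: $\mathbb{N}=\{1,2,3,\dots\}$. The difference operator $\Delta$ acts on scalar sequences by $(\Delta c)_n=c_n-c_{n-1}$, $n\ge 1$, with the convention $c_0=0$; $\Delta^k$ is its $k$-th power, so $(\Delta^k c)_n=\sum_{j=0}^{k}(-1)^j\binom{k}{j}c_{n-j}$ with $c_{m}=0$ for $m\le 0$. Put $\ell_2(\Delta^k)=\{\{c_n\}_{n=1}^{\infty}: \Delta^k\{c_n\}_{n=1}^\infty\in\ell_2\}$. For $k\in\mathbb{N}$, $$\mathcal{S}_k=\Bigl\{\{f(n)\}_{n=1}^{\infty}\subset\mathbb{R}:\ \lim_{n\to\infty}f(n)=+\infty;\ \{n^j\Delta^jf(n)\}_{n=1}^{\infty}\in\ell_\infty\ \text{for } 1\le j\le k\Bigr\}.$$ For a Riesz basis $\{e_n\}_{n=1}^\infty$ of a Hilbert space $H$ with norm $\|\cdot\|$, $H_k(\{e_n\})$ is the space of formal series $x=(\mathfrak{f})\sum_{n=1}^{\infty}c_ne_n$ (identified with their coefficient sequences) with $\{c_n\}_{n=1}^\infty\in\ell_2(\Delta^k)$, with norm $\|x\|_k=\left\|\sum_{n=1}^{\infty}(\Delta^k c)_n e_n\right\|$, the latter series converging in $H$. With the corresponding inner product it is a separable Hilbert space. It is known that $A_k$ generates a $C_0$-group on $H_k(\{e_n\})$ (in particular it is closed and densely defined). *)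

theory Defs
  imports "HOL-Analysis.Analysis" "HOL-Library.Function_Algebras"
begin

text \<open>
  Sequences are indexed by the positive integers and represented as functions on
  \<^typ>\<open>nat\<close>. The value at 0 of a family such as \<open>e\<close> or \<open>f\<close> is never used; sequences that are
  elements of a sequence space are normalised to be 0 at 0, so that distinct functions
  are distinct sequences.
\<close>

section \<open>Complex vector spaces and complex Hilbert spaces\<close>

class complex_vector = ab_group_add +
  fixes scaleC :: "complex \<Rightarrow> 'a \<Rightarrow> 'a"  (infixr \<open>*\<^sub>C\<close> 75)
  assumes scaleC_add_right: "a *\<^sub>C (x + y) = a *\<^sub>C x + a *\<^sub>C y"
    and scaleC_add_left: "(a + b) *\<^sub>C x = a *\<^sub>C x + b *\<^sub>C x"
    and scaleC_scaleC: "a *\<^sub>C (b *\<^sub>C x) = (a * b) *\<^sub>C x"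
    and scaleC_one: "1 *\<^sub>C x = x"

global_interpretation complex_vector:
  vector_space "scaleC :: complex \<Rightarrow> 'a \<Rightarrow> 'a::complex_vector"
  defines cspan = complex_vector.span
  by standard (simp_all add: scaleC_add_right scaleC_add_left scaleC_scaleC scaleC_one)

instantiation complex :: complex_vector
begin

definition scaleC_complex :: "complex \<Rightarrow> complex \<Rightarrow> complex" where
  "scaleC_complex a x = a * x"

instance
  by standard (simp_all add: scaleC_complex_def algebra_simps)

end

instantiation "fun" :: (type, complex_vector) complex_vector
begin

definition scaleC_fun :: "complex \<Rightarrow> ('a \<Rightarrow> 'b) \<Rightarrow> 'a \<Rightarrow> 'b" where
  "scaleC_fun a x = (\<lambda>t. a *\<^sub>C x t)"

instance
  by standard
    (simp_all add: scaleC_fun_def fun_eq_iff scaleC_add_right scaleC_add_left scaleC_scaleC scaleC_one)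

end

text \<open>The inner product is linear in its first argument; completeness comes from
  \<^class>\<open>banach\<close>.\<close>

class complex_hilbert = complex_vector + banach +
  fixes cinner :: "'a \<Rightarrow> 'a \<Rightarrow> complex"
  assumes scaleR_scaleC: "r *\<^sub>R x = complex_of_real r *\<^sub>C x"
    and cinner_commute: "cinner x y = cnj (cinner y x)"
    and cinner_add_left: "cinner (x + y) z = cinner x z + cinner y z"
    and cinner_scaleC_left: "cinner (a *\<^sub>C x) y = a * cinner x y"
    and cinner_self: "cinner x x = complex_of_real ((norm x)\<^sup>2)"

definition orthonormal_basis :: "(nat \<Rightarrow> 'h::complex_hilbert) \<Rightarrow> bool" where
  "orthonormal_basis \<phi> \<longleftrightarrow>
     (\<forall>m\<ge>1. \<forall>n\<ge>1. cinner (\<phi> m) (\<phi> n) = (if m = n then 1 else 0)) \<and>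
     closure (cspan (\<phi> ` {1..})) = UNIV"

definition bounded_clinear :: "('h::complex_hilbert \<Rightarrow> 'h) \<Rightarrow> bool" where
  "bounded_clinear T \<longleftrightarrow> bounded_linear T \<and> (\<forall>a x. T (a *\<^sub>C x) = a *\<^sub>C T x)"

text \<open>A Riesz basis is the image of an orthonormal basis under a boundedly invertible
  operator.\<close>

definition riesz_basis :: "(nat \<Rightarrow> 'h::complex_hilbert) \<Rightarrow> bool" where
  "riesz_basis e \<longleftrightarrow>
     (\<exists>\<phi> T. orthonormal_basis \<phi> \<and> bounded_clinear T \<and> bij T \<and> bounded_clinear (inv T) \<and>
            (\<forall>n\<ge>1. e n = T (\<phi> n)))"

section \<open>Differences, sequence spaces and the operator\<close>

text \<open>The entry before the first one counts as 0, whatever the value of \<open>c 0\<close>.\<close>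

definition bdiff :: "(nat \<Rightarrow> 'a::ab_group_add) \<Rightarrow> nat \<Rightarrow> 'a" where
  "bdiff c n = (if n = 0 then 0 else if n = 1 then c 1 else c n - c (n - 1))"

definition l2_diff :: "nat \<Rightarrow> (nat \<Rightarrow> complex) set" where
  "l2_diff k = {c. c 0 = 0 \<and> summable (\<lambda>n. (cmod ((bdiff ^^ k) c (Suc n)))\<^sup>2)}"

definition S_class :: "nat \<Rightarrow> (nat \<Rightarrow> real) set" where
  "S_class k = {f. filterlim f at_top sequentially \<and>
     (\<forall>j\<in>{1..k}. bounded ((\<lambda>n. real n ^ j * (bdiff ^^ j) f n) ` {1..}))}"

text \<open>The space \<open>H\<^sub>k({e\<^sub>n})\<close> of formal series, identified with their coefficient sequences, is
  the set \<open>l2_diff k\<close> normed by \<open>Hk_norm e k\<close>.\<close>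

definition Hk_norm :: "(nat \<Rightarrow> 'h::complex_hilbert) \<Rightarrow> nat \<Rightarrow> (nat \<Rightarrow> complex) \<Rightarrow> real" where
  "Hk_norm e k c = norm (\<Sum>n. (bdiff ^^ k) c (Suc n) *\<^sub>C e (Suc n))"

definition A_op :: "(nat \<Rightarrow> real) \<Rightarrow> (nat \<Rightarrow> complex) \<Rightarrow> nat \<Rightarrow> complex" where
  "A_op f c = (\<lambda>n. \<i> * complex_of_real (f n) * c n)"

definition A_dom :: "nat \<Rightarrow> (nat \<Rightarrow> real) \<Rightarrow> (nat \<Rightarrow> complex) set" where
  "A_dom k f = {c \<in> l2_diff k. (\<lambda>n. complex_of_real (f n) * c n) \<in> l2_diff k}"

section \<open>Spectrum of an unbounded operator\<close>

text \<open>\<open>X\<close> is the underlying set of the ambient space and \<open>N\<close> its norm; the operator is \<open>A\<close>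
  with domain \<open>D\<close>. The inequality says that the inverse of \<open>A - \<mu>I\<close>, a map from \<open>X\<close> onto \<open>D\<close>,
  is bounded.\<close>

definition resolvent ::
  "'v::complex_vector set \<Rightarrow> ('v \<Rightarrow> 'v) \<Rightarrow> complex \<Rightarrow> 'v \<Rightarrow> 'v" where
  "resolvent D A \<mu> = inv_into D (\<lambda>x. A x - \<mu> *\<^sub>C x)"

definition resolvent_set ::
  "'v::complex_vector set \<Rightarrow> ('v \<Rightarrow> real) \<Rightarrow> 'v set \<Rightarrow> ('v \<Rightarrow> 'v) \<Rightarrow> complex set" where
  "resolvent_set X N D A =
     {\<mu>. bij_betw (\<lambda>x. A x - \<mu> *\<^sub>C x) D X \<and>
         (\<exists>C. \<forall>y\<in>X. N (resolvent D A \<mu> y) \<le> C * N y)}"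

definition spectrum ::
  "'v::complex_vector set \<Rightarrow> ('v \<Rightarrow> real) \<Rightarrow> 'v set \<Rightarrow> ('v \<Rightarrow> 'v) \<Rightarrow> complex set" where
  "spectrum X N D A = - resolvent_set X N D A"

definition point_spectrum :: "'v::complex_vector set \<Rightarrow> ('v \<Rightarrow> 'v) \<Rightarrow> complex set" where
  "point_spectrum D A = {\<mu>. \<exists>x\<in>D. x \<noteq> 0 \<and> A x = \<mu> *\<^sub>C x}"

end

theory Submission
  imports Defs
begin

text \<open>
  Solving \<open>(A - \<mu>)x = c\<close> coordinatewise multiplies \<open>c\<close> by \<open>g(n) = 1/(if(n) - \<mu>)\<close>, so everything
  reduces to the boundedness of this multiplier on \<open>\<ell>\<^sub>2(\<Delta>\<^sup>k)\<close>. Away from \<open>n = 1\<close> one has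
  \<open>\<Delta>g(n) = - i g(n) g(n - 1) \<Delta>f(n)\<close>, whence \<open>\<Delta>\<^sup>j g(n) = O(n\<^sup>-\<^sup>j)\<close> for \<open>j \<le> k\<close> by induction. In the
  Leibniz expansion of \<open>\<Delta>\<^sup>k(gc)\<close> the factors \<open>n\<^sup>-\<^sup>j\<close> are absorbed by Hardy's inequality, which
  bounds \<open>n\<^sup>-\<^sup>j \<Delta>\<^sup>k\<^sup>-\<^sup>j c\<close> in \<open>\<ell>\<^sub>2\<close> by \<open>\<Delta>\<^sup>k c\<close>. All these maps are causal, so the estimates
  already hold for the finite sections \<open>{1..N}\<close> and no convergence has to be discussed.
\<close>

section \<open>Backward differences\<close>

text \<open>The entry moved into position 1 is 0, never \<open>c 0\<close>, matching
  \<open>bdiff\<close>; this keeps the product rule and the commutation with \<open>bdiff\<close>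
  valid at every index.\<close>

definition shift :: "(nat \<Rightarrow> 'a::zero) \<Rightarrow> nat \<Rightarrow> 'a" where
  "shift c n = (if n \<le> 1 then 0 else c (n - 1))"

lemma bdiff_add: "bdiff (u + v) = bdiff u + bdiff v"
  by (auto simp: bdiff_def fun_eq_iff)

text \<open>Discrete Leibniz rule, by inserting the mixed term \<open>u n * v (n - 1)\<close>. Only
  the second factor gets shifted.\<close>

lemma bdiff_mult:
  fixes u v :: "nat \<Rightarrow> 'a::ring"
  shows "bdiff (u * v) = u * bdiff v + bdiff u * shift v"
  by (auto simp: bdiff_def shift_def fun_eq_iff algebra_simps)

lemma bdiff_shift: "bdiff (shift c) = shift (bdiff c)"
proof
  fix n show "bdiff (shift c) n = shift (bdiff c) n"
    by (cases "n \<le> 2") (auto simp: bdiff_def shift_def le_Suc_eq numeral_2_eq_2)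
qed

lemma bdiff_scale:
  fixes u :: "nat \<Rightarrow> 'a::ring"
  shows "bdiff (\<lambda>n. a * u n) = (\<lambda>n. a * bdiff u n)"
  by (auto simp: bdiff_def fun_eq_iff algebra_simps)

lemma bdiff_of_real: "bdiff (\<lambda>n. of_real (f n)) = (\<lambda>n. complex_of_real (bdiff f n))"
  by (auto simp: bdiff_def fun_eq_iff)

lemma bdiff_pow_add: "(bdiff ^^ k) (u + v) = (bdiff ^^ k) u + (bdiff ^^ k) v"
  by (induction k) (simp_all only: funpow.simps id_apply comp_apply bdiff_add)

lemma bdiff_pow_scale:
  fixes u :: "nat \<Rightarrow> 'a::ring"
  shows "(bdiff ^^ k) (\<lambda>n. a * u n) = (\<lambda>n. a * (bdiff ^^ k) u n)"
  by (induction k) (simp_all add: bdiff_scale)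

lemma bdiff_pow_shift: "(bdiff ^^ k) (shift c) = shift ((bdiff ^^ k) c)"
  by (induction k) (simp_all add: bdiff_shift)

lemma bdiff_pow_of_real:
  "(bdiff ^^ k) (\<lambda>n. of_real (f n)) = (\<lambda>n. complex_of_real ((bdiff ^^ k) f n))"
  by (induction k) (simp_all add: bdiff_of_real)

lemma bdiff_pow_eq_0:
  assumes "\<And>n. n > M \<Longrightarrow> u n = 0" and "n > M + k"
  shows "(bdiff ^^ k) u n = 0"
  using assms(2) by (induction k arbitrary: n) (auto simp: bdiff_def assms(1))

section \<open>Sequences with decaying differences\<close>

text \<open>The bound u(n) = O(n^-j), multiplied out; the entry at 0 is left free.\<close>

definition decay :: "nat \<Rightarrow> (nat \<Rightarrow> complex) \<Rightarrow> bool" where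
  "decay j u \<longleftrightarrow> (\<exists>C. \<forall>n\<ge>1. cmod (u n) * real n ^ j \<le> C)"

text \<open>A discrete symbol class: the i-th difference is O(n^-(i+j)) for i \<le> m, as
  \<open>diff_decay_iff\<close> confirms. The recursive form lets inductions peel off one difference
  while j grows by one.\<close>

primrec diff_decay :: "nat \<Rightarrow> nat \<Rightarrow> (nat \<Rightarrow> complex) \<Rightarrow> bool" where
  "diff_decay 0 j u = decay j u"
| "diff_decay (Suc m) j u = (decay j u \<and> diff_decay m (Suc j) (bdiff u))"

lemma decay_add:
  assumes "decay j u" "decay j v"
  shows "decay j (u + v)"
proof -
  obtain C D where C: "\<And>n. n \<ge> 1 \<Longrightarrow> cmod (u n) * real n ^ j \<le> C"
    and D: "\<And>n. n \<ge> 1 \<Longrightarrow> cmod (v n) * real n ^ j \<le> D"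
    using assms unfolding decay_def by blast
  have "cmod ((u + v) n) * real n ^ j \<le> C + D" if "n \<ge> 1" for n
  proof -
    have "cmod ((u + v) n) * real n ^ j \<le> (cmod (u n) + cmod (v n)) * real n ^ j"
      by (auto intro!: mult_right_mono norm_triangle_ineq)
    with C[OF that] D[OF that] show ?thesis by (simp add: distrib_right)
  qed
  then show ?thesis unfolding decay_def by blast
qed

lemma decay_mult:
  assumes "decay j u" "decay l v"
  shows "decay (j + l) (u * v)"
proof -
  obtain C D where C: "\<And>n. n \<ge> 1 \<Longrightarrow> cmod (u n) * real n ^ j \<le> C"
    and D: "\<And>n. n \<ge> 1 \<Longrightarrow> cmod (v n) * real n ^ l \<le> D"
    using assms unfolding decay_def by blast
  have C0: "0 \<le> C" using C[of 1] by (simp, smt (verit) norm_ge_zero)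
  have "cmod ((u * v) n) * real n ^ (j + l) \<le> C * D" if "n \<ge> 1" for n
  proof -
    have "cmod ((u * v) n) * real n ^ (j + l) = (cmod (u n) * real n ^ j) * (cmod (v n) * real n ^ l)"
      by (simp add: norm_mult power_add)
    also have "\<dots> \<le> C * D"
      using C[OF that] D[OF that] C0 by (intro mult_mono) auto
    finally show ?thesis .
  qed
  then show ?thesis unfolding decay_def by blast
qed

text \<open>For n \<ge> 2 one has n \<le> 2(n - 1), so shifting costs at most a factor 2^j.\<close>

lemma decay_shift:
  assumes "decay j u"
  shows "decay j (shift u)"
proof -
  obtain C where C: "\<And>n. n \<ge> 1 \<Longrightarrow> cmod (u n) * real n ^ j \<le> C"
    using assms unfolding decay_def by blast
  have C0: "0 \<le> C" using C[of 1] by (simp, smt (verit) norm_ge_zero)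
  have "cmod (shift u n) * real n ^ j \<le> 2 ^ j * C" if "n \<ge> 1" for n
  proof (cases "n = 1")
    case True
    with C0 show ?thesis by (simp add: shift_def)
  next
    case False
    with that have n: "n \<ge> 2" by simp
    have "real n ^ j \<le> (2 * real (n - 1)) ^ j"
      using n by (intro power_mono) auto
    then have "cmod (shift u n) * real n ^ j \<le> cmod (u (n - 1)) * (2 * real (n - 1)) ^ j"
      using n by (auto simp: shift_def intro!: mult_left_mono)
    also have "\<dots> = 2 ^ j * (cmod (u (n - 1)) * real (n - 1) ^ j)"
      by (simp add: power_mult_distrib)
    also have "\<dots> \<le> 2 ^ j * C"
      using C[of "n - 1"] n by (intro mult_left_mono) auto
    finally show ?thesis .
  qed
  then show ?thesis unfolding decay_def by blast
qed

text \<open>The sum of the finitely many weighted entries is a bound. This absorbs the boundary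
  terms that arise at n = 1.\<close>

lemma decay_finite_support:
  assumes "\<And>n. n > M \<Longrightarrow> u n = 0"
  shows "decay j u"
proof -
  have "cmod (u n) * real n ^ j \<le> (\<Sum>i\<le>M. cmod (u i) * real i ^ j)" for n
  proof (cases "n \<le> M")
    case True
    then show ?thesis by (intro member_le_sum) auto
  next
    case False
    with assms show ?thesis by (auto intro!: sum_nonneg)
  qed
  then show ?thesis unfolding decay_def by blast
qed

lemma diff_decay_imp_decay: "diff_decay m j u \<Longrightarrow> decay j u"
  by (cases m) auto

lemma diff_decay_Suc_imp: "diff_decay (Suc m) j u \<Longrightarrow> diff_decay m j u"
  by (induction m arbitrary: j u) auto

lemma diff_decay_add:
  "diff_decay m j u \<Longrightarrow> diff_decay m j v \<Longrightarrow> diff_decay m j (u + v)"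
  by (induction m arbitrary: j u v) (auto simp: decay_add bdiff_add)

lemma diff_decay_shift: "diff_decay m j u \<Longrightarrow> diff_decay m j (shift u)"
  by (induction m arbitrary: j u) (auto simp: decay_shift bdiff_shift)

lemma diff_decay_finite_support:
  assumes "\<And>n. n > M \<Longrightarrow> u n = 0"
  shows "diff_decay m j u"
  using assms
proof (induction m arbitrary: j u M)
  case (Suc m)
  have "diff_decay m (Suc j) (bdiff u)"
    \<comment> \<open>A difference lengthens the support by one index.\<close>
    by (rule Suc.IH[of "Suc M"]) (auto simp: bdiff_def Suc.prems)
  with decay_finite_support[OF Suc.prems] show ?case by simp
qed (auto intro: decay_finite_support)

text \<open>Orders add as for symbols: each Leibniz term has one differenced factor, whose order
  rises by one, so the induction hypothesis applies with j or l increased.\<close>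

lemma diff_decay_mult:
  "diff_decay m j u \<Longrightarrow> diff_decay m l v \<Longrightarrow> diff_decay m (j + l) (u * v)"
proof (induction m arbitrary: j l u v)
  case (Suc m)
  have "diff_decay m (j + Suc l) (u * bdiff v)"
    using Suc.prems by (intro Suc.IH) (simp_all add: diff_decay_Suc_imp)
  moreover have "diff_decay m (Suc j + l) (bdiff u * shift v)"
    using Suc.prems by (intro Suc.IH diff_decay_shift) (simp_all add: diff_decay_Suc_imp)
  ultimately have "diff_decay m (Suc (j + l)) (bdiff (u * v))"
    unfolding bdiff_mult by (intro diff_decay_add) simp_all
  with Suc.prems decay_mult show ?case by (simp only: diff_decay.simps)
qed (simp only: diff_decay.simps decay_mult)

lemma diff_decay_iff: "diff_decay m j u \<longleftrightarrow> (\<forall>i\<le>m. decay (i + j) ((bdiff ^^ i) u))"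
proof (induction m arbitrary: j u)
  case (Suc m)
  have "(\<forall>i\<le>Suc m. decay (i + j) ((bdiff ^^ i) u)) \<longleftrightarrow>
      decay j u \<and> (\<forall>i\<le>m. decay (Suc i + j) ((bdiff ^^ Suc i) u))"
    unfolding less_Suc_eq_le[symmetric] All_less_Suc2 by simp
  then show ?case
    by (simp add: Suc.IH funpow_swap1)
qed simp

section \<open>Decay of the differences of f and of 1/(if(n) - mu)\<close>

text \<open>Since f is unbounded, the class is entered through its first difference, with order 1:
  difference i of \<open>bdiff f\<close> is difference i + 1 of f.\<close>

lemma diff_decay_S_class:
  assumes "f \<in> S_class k" "Suc m \<le> k"
  shows "diff_decay m 1 (bdiff (\<lambda>n. complex_of_real (f n)))"
  unfolding diff_decay_iff
proof (intro allI impI)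
  fix i assume "i \<le> m"
  with assms have "bounded ((\<lambda>n. real n ^ Suc i * (bdiff ^^ Suc i) f n) ` {1..})"
    unfolding S_class_def by (auto simp del: power_Suc funpow.simps)
  then obtain C where "\<And>n. n \<ge> 1 \<Longrightarrow> \<bar>real n ^ Suc i * (bdiff ^^ Suc i) f n\<bar> \<le> C"
    unfolding bounded_iff by (auto simp del: power_Suc funpow.simps)
  then have "\<forall>n\<ge>1. cmod ((bdiff ^^ Suc i) (\<lambda>n. complex_of_real (f n)) n) * real n ^ Suc i \<le> C"
    by (simp add: bdiff_pow_of_real abs_mult mult.commute del: power_Suc funpow.simps)
  then have "decay (Suc i) ((bdiff ^^ Suc i) (\<lambda>n. complex_of_real (f n)))"
    unfolding decay_def by blast
  then show "decay (i + 1) ((bdiff ^^ i) (bdiff (\<lambda>n. complex_of_real (f n))))"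
    by (simp add: funpow_swap1)
qed

text \<open>Far out, |if(n) - mu| \<ge> f(n) - |mu| \<ge> 1. The finitely many earlier values,
  including any quotient by zero (which is 0), are bounded by their sum.\<close>

lemma decay_0_resolvent:
  assumes "filterlim f at_top sequentially"
  shows "decay 0 (\<lambda>n. 1 / (\<i> * complex_of_real (f n) - \<mu>))"
proof -
  have "eventually (\<lambda>n. f n \<ge> 1 + cmod \<mu>) sequentially"
    using assms by (simp add: filterlim_at_top)
  then obtain M where M: "\<And>n. n \<ge> M \<Longrightarrow> f n \<ge> 1 + cmod \<mu>"
    by (auto simp: eventually_sequentially)
  let ?g = "\<lambda>n. 1 / (\<i> * complex_of_real (f n) - \<mu>)"
  have "cmod (?g n) \<le> 1 + (\<Sum>i\<le>M. cmod (?g i))" for n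
  proof (cases "n \<le> M")
    case True
    then have "cmod (?g n) \<le> (\<Sum>i\<le>M. cmod (?g i))"
      by (intro member_le_sum) auto
    then show ?thesis by simp
  next
    case False
    have "1 \<le> f n - cmod \<mu>" using M[of n] False by simp
    also have "\<dots> \<le> cmod (\<i> * complex_of_real (f n)) - cmod \<mu>"
      by (simp add: norm_mult)
    also have "\<dots> \<le> cmod (\<i> * complex_of_real (f n) - \<mu>)"
      by (rule norm_triangle_ineq2)
    finally have "cmod (?g n) \<le> 1" by (simp add: norm_divide divide_le_eq_1)
    moreover have "0 \<le> (\<Sum>i\<le>M. cmod (?g i))" by (intro sum_nonneg) auto
    ultimately show ?thesis by linarith
  qed
  then show ?thesis unfolding decay_def by auto
qed

text \<open>The difference of g is g times its shift times the difference of f, up to a constant and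
  a boundary term. Knowing g to depth m thus controls \<open>bdiff g\<close> to depth m with order
  1, hence g to depth m + 1.\<close>

lemma diff_decay_resolvent:
  assumes f: "f \<in> S_class k" and "m \<le> k"
    and \<mu>: "\<And>n. n \<ge> 1 \<Longrightarrow> \<i> * complex_of_real (f n) \<noteq> \<mu>"
  shows "diff_decay m 0 (\<lambda>n. 1 / (\<i> * complex_of_real (f n) - \<mu>))"
    (is "diff_decay m 0 ?g")
  using \<open>m \<le> k\<close>
proof (induction m)
  case 0
  from f show ?case by (simp add: S_class_def decay_0_resolvent)
next
  case (Suc m)
  let ?F = "bdiff (\<lambda>n. complex_of_real (f n))"
  \<comment> \<open>At n = 1 the shifted factor vanishes while \<open>bdiff\<close> returns the
    entry itself; \<open>?d\<close> restores it.\<close>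
  let ?d = "\<lambda>n. if n = 1 then ?g 1 else 0"
  have eq: "bdiff ?g = ((\<lambda>_. - \<i>) * ((?g * shift ?g) * ?F)) + ?d"
  proof
    fix n :: nat
    consider "n = 0" | "n = 1" | "n \<ge> 2" by linarith
    then show "bdiff ?g n = (((\<lambda>_. - \<i>) * ((?g * shift ?g) * ?F)) + ?d) n"
    proof cases
      case 3
      have "\<i> * complex_of_real (f n) \<noteq> \<mu>" "\<i> * complex_of_real (f (n - 1)) \<noteq> \<mu>"
        using 3 by (auto intro!: \<mu>)
      with 3 show ?thesis by (simp add: bdiff_def shift_def divide_simps) (simp add: algebra_simps)
    qed (simp_all add: bdiff_def shift_def)
  qed
  \<comment> \<open>A constant sequence has a nonzero difference at n = 1, because the entry before
    the first counts as 0; this difference has finite support.\<close>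
  have const: "diff_decay m 0 (\<lambda>_. - \<i>)"
  proof (cases m)
    case (Suc l)
    have "diff_decay l 1 (bdiff (\<lambda>_. - \<i>))"
      by (rule diff_decay_finite_support[of 1]) (simp add: bdiff_def)
    with Suc show ?thesis by (auto simp: decay_def)
  qed (auto simp: decay_def)
  from Suc have g: "diff_decay m 0 ?g" by simp
  have "diff_decay m (0 + ((0 + 0) + 1)) ((\<lambda>_. - \<i>) * ((?g * shift ?g) * ?F))"
    using Suc.prems by (intro diff_decay_mult diff_decay_shift diff_decay_S_class[OF f] g const)
  moreover have "diff_decay m 1 ?d"
    by (rule diff_decay_finite_support[of 1]) simp
  ultimately have "diff_decay m 1 (bdiff ?g)"
    unfolding eq by (intro diff_decay_add) simp_all
  with diff_decay_imp_decay[OF g] show ?case by simp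
qed

section \<open>Hardy's inequality and multipliers\<close>

definition l2_part :: "nat \<Rightarrow> (nat \<Rightarrow> complex) \<Rightarrow> real" where
  "l2_part N a = L2_set (\<lambda>n. cmod (a n)) {1..N}"

lemma l2_part_nonneg: "0 \<le> l2_part N a"
  by (simp add: l2_part_def)

lemma l2_part_add: "l2_part N (a + b) \<le> l2_part N a + l2_part N b"
proof -
  have "l2_part N (a + b) \<le> L2_set (\<lambda>n. cmod (a n) + cmod (b n)) {1..N}"
    unfolding l2_part_def by (intro L2_set_mono) (auto intro: norm_triangle_ineq)
  also have "\<dots> \<le> l2_part N a + l2_part N b"
    unfolding l2_part_def by (rule L2_set_triangle_ineq)
  finally show ?thesis .
qed

text \<open>Inside the section the shift only discards the last entry.\<close>

lemma l2_part_shift: "l2_part N (shift a) \<le> l2_part N a"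
proof -
  have "(\<Sum>n=1..N. (cmod (shift a n))\<^sup>2) \<le> (\<Sum>n=1..N. (cmod (a n))\<^sup>2)"
  proof (cases N)
    case (Suc M)
    have "(\<Sum>n=1..Suc M. (cmod (shift a n))\<^sup>2) = (\<Sum>n=1..M. (cmod (a n))\<^sup>2)"
      by (induction M) (auto simp: shift_def)
    with Suc show ?thesis by simp
  qed simp
  then show ?thesis
    unfolding l2_part_def L2_set_def by simp
qed

text \<open>Elliott's telescoping argument; the extra term on the left makes the induction work.\<close>

lemma hardy_sum:
  fixes a :: "nat \<Rightarrow> real"
  defines "\<alpha> \<equiv> \<lambda>n. (\<Sum>i=1..n. a i) / real n"
  shows "(\<Sum>n=1..N. (\<alpha> n)\<^sup>2) + 2 * real N * (\<alpha> N)\<^sup>2 \<le> 4 * (\<Sum>n=1..N. (a n)\<^sup>2)"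
proof (induction N)
  case (Suc N)
  define x where "x = \<alpha> (Suc N)"
  define y where "y = \<alpha> N"
  \<comment> \<open>The form multiplied by N also covers N = 0, where the average is a division by
    zero.\<close>
  have y: "real N * y = (\<Sum>i=1..N. a i)"
    by (cases "N = 0") (simp_all add: y_def \<alpha>_def)
  have a: "a (Suc N) = (real N + 1) * x - real N * y"
    unfolding y by (simp add: x_def \<alpha>_def field_simps)
  \<comment> \<open>The amount by which the right side of the claim grows from N to N + 1, minus the
    growth of the left side, is a sum of squares.\<close>
  have "4 * (a (Suc N))\<^sup>2 - x\<^sup>2 - 2 * (real N + 1) * x\<^sup>2 + 2 * real N * y\<^sup>2
      = (x - 2 * a (Suc N))\<^sup>2 + 2 * real N * (x - y)\<^sup>2"
    unfolding a by (simp add: power2_eq_square algebra_simps)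
  also have "\<dots> \<ge> 0" by simp
  finally have "x\<^sup>2 + 2 * (real N + 1) * x\<^sup>2 \<le> 4 * (a (Suc N))\<^sup>2 + 2 * real N * y\<^sup>2"
    by simp
  with Suc.IH show ?case
    unfolding x_def y_def by (simp add: add.commute algebra_simps)
qed simp

lemma hardy_L2_set:
  "L2_set (\<lambda>n. (\<Sum>i=1..n. a i) / real n) {1..N} \<le> 2 * L2_set a {1..N}"
proof -
  have "(\<Sum>n=1..N. ((\<Sum>i=1..n. a i) / real n)\<^sup>2) \<le> 4 * (\<Sum>n=1..N. (a n)\<^sup>2)"
    using hardy_sum[where a=a and N=N] by (smt (verit) mult_nonneg_nonneg of_nat_0_le_iff zero_le_power2)
  then have "sqrt (\<Sum>n=1..N. ((\<Sum>i=1..n. a i) / real n)\<^sup>2) \<le> sqrt (2\<^sup>2 * (\<Sum>n=1..N. (a n)\<^sup>2))"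
    by simp
  then show ?thesis
    unfolding L2_set_def by (simp add: real_sqrt_mult)
qed

section \<open>Hardy's inequality for differences, and the multiplier estimate\<close>

lemma norm_le_sum_bdiff: "cmod (c n) \<le> (\<Sum>i=1..n. cmod (bdiff c i))" if "n \<ge> 1"
  using that
proof (induction n rule: nat_induct_at_least)
  case (Suc n)
  then have "cmod (c (Suc n)) \<le> cmod (c n) + cmod (bdiff c (Suc n))"
    using norm_triangle_ineq[of "c n" "c (Suc n) - c n"] by (simp add: bdiff_def)
  with Suc.IH show ?case by simp
qed (simp add: bdiff_def)

text \<open>Telescoping bounds |c(n)| by the sum of the |\<open>bdiff c i\<close>| with i \<le> n,
  and n^-j \<le> i^-j moves the weight inside the sum. The remaining 1/n makes an average, to which
  Hardy's inequality applies.\<close>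

lemma hardy_bdiff:
  "L2_set (\<lambda>n. cmod (c n) / real n ^ Suc j) {1..N}
     \<le> 2 * L2_set (\<lambda>n. cmod (bdiff c n) / real n ^ j) {1..N}"
proof -
  have "cmod (c n) / real n ^ Suc j \<le> (\<Sum>i=1..n. cmod (bdiff c i) / real i ^ j) / real n"
    if "n \<ge> 1" for n
  proof -
    have "cmod (c n) / real n ^ j \<le> (\<Sum>i=1..n. cmod (bdiff c i)) / real n ^ j"
      using norm_le_sum_bdiff[OF that] by (intro divide_right_mono) auto
    also have "\<dots> \<le> (\<Sum>i=1..n. cmod (bdiff c i) / real i ^ j)"
      unfolding sum_divide_distrib
      by (intro sum_mono divide_left_mono power_mono mult_pos_pos) auto
    finally have "cmod (c n) / real n ^ j / real n
        \<le> (\<Sum>i=1..n. cmod (bdiff c i) / real i ^ j) / real n"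
      by (intro divide_right_mono) auto
    then show ?thesis by (simp add: mult.commute)
  qed
  then have "L2_set (\<lambda>n. cmod (c n) / real n ^ Suc j) {1..N}
      \<le> L2_set (\<lambda>n. (\<Sum>i=1..n. cmod (bdiff c i) / real i ^ j) / real n) {1..N}"
    by (intro L2_set_mono) auto
  also have "\<dots> \<le> 2 * L2_set (\<lambda>n. cmod (bdiff c n) / real n ^ j) {1..N}"
    by (rule hardy_L2_set)
  finally show ?thesis .
qed

lemma hardy_bdiff_pow:
  "L2_set (\<lambda>n. cmod (c n) / real n ^ j) {1..N} \<le> 2 ^ j * l2_part N ((bdiff ^^ j) c)"
proof (induction j arbitrary: c)
  case (Suc j)
  show ?case
    using hardy_bdiff[of c j N] Suc.IH[of "bdiff c"]
    by (simp add: funpow_swap1)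
qed (simp add: l2_part_def)

text \<open>One difference is moved off the product per induction step; it falls either on \<open>c\<close>, or on
  \<open>g\<close>, which then gains one order of decay.\<close>

lemma diff_decay_multiplier:
  "diff_decay m j g \<Longrightarrow>
    \<exists>K. \<forall>c N. l2_part N ((bdiff ^^ m) (g * c)) \<le> K * l2_part N ((bdiff ^^ (m + j)) c)"
proof (induction m arbitrary: j g)
  case 0
  then obtain C where C: "\<And>n. n \<ge> 1 \<Longrightarrow> cmod (g n) * real n ^ j \<le> C"
    unfolding diff_decay.simps decay_def by blast
  have C0: "0 \<le> C" using C[of 1] by (simp, smt (verit) norm_ge_zero)
  have "l2_part N (g * c) \<le> C * 2 ^ j * l2_part N ((bdiff ^^ j) c)" for c N
  proof -
    \<comment> \<open>The weight n^j is given to g, which stays bounded; the compensating n^-j on c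
      is traded for j differences by Hardy's inequality.\<close>
    have "cmod ((g * c) n) \<le> C * (cmod (c n) / real n ^ j)" if "n \<ge> 1" for n
    proof -
      have "cmod ((g * c) n) = (cmod (g n) * real n ^ j) * (cmod (c n) / real n ^ j)"
        using that by (simp add: norm_mult)
      also have "\<dots> \<le> C * (cmod (c n) / real n ^ j)"
        using C[OF that] by (intro mult_right_mono) auto
      finally show ?thesis .
    qed
    then have "l2_part N (g * c) \<le> L2_set (\<lambda>n. C * (cmod (c n) / real n ^ j)) {1..N}"
      unfolding l2_part_def by (intro L2_set_mono) auto
    also have "\<dots> = C * L2_set (\<lambda>n. cmod (c n) / real n ^ j) {1..N}"
      using C0 by (simp add: L2_set_right_distrib)
    also have "\<dots> \<le> C * (2 ^ j * l2_part N ((bdiff ^^ j) c))"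
      by (rule mult_left_mono[OF hardy_bdiff_pow C0])
    finally show ?thesis by simp
  qed
  then show ?case by (simp only: funpow_0 add_0) blast
next
  case (Suc m)
  obtain K where K: "\<And>c N. l2_part N ((bdiff ^^ m) (g * c)) \<le> K * l2_part N ((bdiff ^^ (m + j)) c)"
    using Suc.IH[OF diff_decay_Suc_imp[OF Suc.prems]] by blast
  obtain L where L: "\<And>c N. l2_part N ((bdiff ^^ m) (bdiff g * c))
      \<le> L * l2_part N ((bdiff ^^ (m + Suc j)) c)"
    using Suc.IH[of "Suc j" "bdiff g"] Suc.prems by (simp only: diff_decay.simps) blast
  have "l2_part N ((bdiff ^^ Suc m) (g * c))
      \<le> (K + \<bar>L\<bar>) * l2_part N ((bdiff ^^ (Suc m + j)) c)" for c N
  proof -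
    \<comment> \<open>The innermost difference is expanded by Leibniz, leaving m differences of
      products with g and with \<open>bdiff g\<close>.\<close>
    have "(bdiff ^^ Suc m) (g * c)
        = (bdiff ^^ m) (g * bdiff c) + (bdiff ^^ m) (bdiff g * shift c)"
      unfolding funpow_Suc_right comp_def by (simp only: bdiff_mult bdiff_pow_add)
    then have "l2_part N ((bdiff ^^ Suc m) (g * c))
        \<le> l2_part N ((bdiff ^^ m) (g * bdiff c)) + l2_part N ((bdiff ^^ m) (bdiff g * shift c))"
      by (simp only: l2_part_add)
    also have "\<dots> \<le> K * l2_part N ((bdiff ^^ (m + j)) (bdiff c))
        + L * l2_part N ((bdiff ^^ (m + Suc j)) (shift c))"
      by (intro add_mono K L)
    also have "(bdiff ^^ (m + j)) (bdiff c) = (bdiff ^^ (Suc m + j)) c"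
      by (simp add: funpow_swap1)
    \<comment> \<open>The extra order of \<open>bdiff g\<close> costs one more difference of c, so
      both terms involve m + j + 1 differences. The absolute value is taken because the sign of L is
      unknown.\<close>
    also have "L * l2_part N ((bdiff ^^ (m + Suc j)) (shift c))
        \<le> \<bar>L\<bar> * l2_part N ((bdiff ^^ (Suc m + j)) c)"
      unfolding bdiff_pow_shift add_Suc_shift
      by (intro mult_mono l2_part_shift l2_part_nonneg) auto
    finally show ?thesis by (simp only: distrib_right)
  qed
  then show ?case by blast
qed

section \<open>The norm of a Riesz basis\<close>

definition l2_nrm :: "(nat \<Rightarrow> complex) \<Rightarrow> real" where
  "l2_nrm a = sqrt (\<Sum>n. (cmod (a (Suc n)))\<^sup>2)"

lemma l2_part_alt: "l2_part N a = sqrt (\<Sum>n<N. (cmod (a (Suc n)))\<^sup>2)"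
proof -
  have "(\<Sum>n=1..N. (cmod (a n))\<^sup>2) = (\<Sum>n<N. (cmod (a (Suc n)))\<^sup>2)"
    by (induction N) auto
  then show ?thesis by (simp add: l2_part_def L2_set_def)
qed

lemma l2_part_le_l2_nrm:
  assumes "summable (\<lambda>n. (cmod (a (Suc n)))\<^sup>2)"
  shows "l2_part N a \<le> l2_nrm a"
  unfolding l2_part_alt l2_nrm_def using assms by (auto intro!: sum_le_suminf)

text \<open>Passage from sections to the whole sequence: partial sums of nonnegative terms with a
  uniform bound converge.\<close>

lemma l2_bounded_partial:
  assumes "\<And>N. l2_part N a \<le> B"
  shows "summable (\<lambda>n. (cmod (a (Suc n)))\<^sup>2)" and "l2_nrm a \<le> B"
proof -
  have B: "0 \<le> B" using assms[of 0] l2_part_nonneg[of 0 a] by linarith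
  have le: "(\<Sum>n<N. (cmod (a (Suc n)))\<^sup>2) \<le> B\<^sup>2" for N
    using assms[of N] B unfolding l2_part_alt by (auto intro!: sqrt_le_D)
  show s: "summable (\<lambda>n. (cmod (a (Suc n)))\<^sup>2)"
    by (rule summableI_nonneg_bounded[of _ "B\<^sup>2"]) (auto simp: le)
  show "l2_nrm a \<le> B"
    unfolding l2_nrm_def using suminf_le_const[OF s le] B by (intro real_le_lsqrt) auto
qed

section \<open>Orthonormal series and their images under T\<close>

lemma cinner_sum_left: "cinner (\<Sum>i\<in>I. u i) z = (\<Sum>i\<in>I. cinner (u i) z)"
proof (induction I rule: infinite_finite_induct)
  case empty
  have "cinner (0 + 0) z = cinner 0 z + cinner 0 z" by (rule cinner_add_left)
  then show ?case by simp
next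
  case (infinite A)
  have "cinner (0 + 0) z = cinner 0 z + cinner 0 z" by (rule cinner_add_left)
  with infinite show ?case by simp
qed (simp add: cinner_add_left)

text \<open>Pythagoras. The index 0 is excluded because orthonormality is prescribed from index 1 on
  only.\<close>

lemma orthonormal_norm_sum:
  assumes "orthonormal_basis \<phi>" "finite I" "0 \<notin> I"
  shows "(norm (\<Sum>n\<in>I. a n *\<^sub>C \<phi> n))\<^sup>2 = (\<Sum>n\<in>I. (cmod (a n))\<^sup>2)"
proof -
  have on: "cinner (\<phi> m) (\<phi> n) = (if m = n then 1 else 0)" if "m \<in> I" "n \<in> I" for m n
    using assms that unfolding orthonormal_basis_def by (metis less_one not_le)
  let ?s = "\<Sum>n\<in>I. a n *\<^sub>C \<phi> n"
  have r: "cinner (\<phi> m) ?s = cnj (a m)" if m: "m \<in> I" for m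
  proof -
    have "cinner ?s (\<phi> m) = (\<Sum>n\<in>I. if n = m then a n else 0)"
      unfolding cinner_sum_left cinner_scaleC_left using m
      by (intro sum.cong) (auto simp: on)
    also have "\<dots> = a m" using m assms(2) by simp
    finally show ?thesis using cinner_commute[of "\<phi> m" ?s] by simp
  qed
  have "complex_of_real ((norm ?s)\<^sup>2) = cinner ?s ?s"
    by (simp add: cinner_self)
  also have "\<dots> = (\<Sum>n\<in>I. a n * cnj (a n))"
    by (subst cinner_sum_left) (auto simp: cinner_scaleC_left r intro!: sum.cong)
  also have "\<dots> = complex_of_real (\<Sum>n\<in>I. (cmod (a n))\<^sup>2)"
    by (simp add: complex_norm_square del: of_real_power)
  finally show ?thesis using of_real_eq_iff by blast
qed

text \<open>Pythagoras on blocks turns the Cauchy criterion for the squared coefficients into the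
  one for the series; the norm identity follows by continuity.\<close>

lemma orthonormal_series:
  assumes "orthonormal_basis \<phi>" and a: "summable (\<lambda>n. (cmod (a (Suc n)))\<^sup>2)"
  shows "summable (\<lambda>n. a (Suc n) *\<^sub>C \<phi> (Suc n))"
    and "norm (\<Sum>n. a (Suc n) *\<^sub>C \<phi> (Suc n)) = l2_nrm a"
proof -
  let ?t = "\<lambda>n. a (Suc n) *\<^sub>C \<phi> (Suc n)"
  have nrm: "(norm (\<Sum>n\<in>I. ?t n))\<^sup>2 = (\<Sum>n\<in>I. (cmod (a (Suc n)))\<^sup>2)" if "finite I" for I
    using orthonormal_norm_sum[OF assms(1), of "Suc ` I" a] that
    by (simp add: sum.reindex)
  show s: "summable ?t"
    unfolding summable_Cauchy
  proof (intro allI impI)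
    fix \<epsilon> :: real assume "\<epsilon> > 0"
    then have "\<epsilon>\<^sup>2 > 0" by simp
    with a obtain N where N: "\<And>m n. m \<ge> N \<Longrightarrow> norm (\<Sum>i=m..<n. (cmod (a (Suc i)))\<^sup>2) < \<epsilon>\<^sup>2"
      unfolding summable_Cauchy by blast
    have "norm (\<Sum>i=m..<n. ?t i) < \<epsilon>" if "m \<ge> N" for m n
    proof -
      have "(norm (\<Sum>i=m..<n. ?t i))\<^sup>2 < \<epsilon>\<^sup>2"
        using N[OF that, of n] unfolding nrm[OF finite_atLeastLessThan] by simp
      with \<open>\<epsilon> > 0\<close> show ?thesis by (simp add: power_less_imp_less_base)
    qed
    then show "\<exists>N. \<forall>m\<ge>N. \<forall>n. norm (\<Sum>i=m..<n. ?t i) < \<epsilon>" by blast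
  qed
  have "(\<lambda>N. (norm (\<Sum>n<N. ?t n))\<^sup>2) \<longlonglongrightarrow> (norm (\<Sum>n. ?t n))\<^sup>2"
    by (intro tendsto_intros summable_LIMSEQ s)
  moreover have "(\<lambda>N. (norm (\<Sum>n<N. ?t n))\<^sup>2) \<longlonglongrightarrow> (\<Sum>n. (cmod (a (Suc n)))\<^sup>2)"
    unfolding nrm[OF finite_lessThan] by (rule summable_LIMSEQ[OF a])
  ultimately have eq: "(norm (\<Sum>n. ?t n))\<^sup>2 = (\<Sum>n. (cmod (a (Suc n)))\<^sup>2)"
    by (rule LIMSEQ_unique)
  show "norm (\<Sum>n. ?t n) = l2_nrm a"
    unfolding l2_nrm_def by (rule real_sqrt_unique[OF eq norm_ge_zero, symmetric])
qed

text \<open>By continuity T carries the series in \<phi> to the series in e, and the former has norm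
  \<open>l2_nrm a\<close>. Hence P and Q are bounds for T and its inverse.\<close>

lemma riesz_basis_norm_equiv:
  fixes e :: "nat \<Rightarrow> 'h::complex_hilbert"
  assumes "riesz_basis e"
  obtains P Q where "P \<ge> 0" "Q \<ge> 0"
    and "\<And>a. summable (\<lambda>n. (cmod (a (Suc n)))\<^sup>2) \<Longrightarrow>
        norm (\<Sum>n. a (Suc n) *\<^sub>C e (Suc n)) \<le> P * l2_nrm a"
    and "\<And>a. summable (\<lambda>n. (cmod (a (Suc n)))\<^sup>2) \<Longrightarrow>
        l2_nrm a \<le> Q * norm (\<Sum>n. a (Suc n) *\<^sub>C e (Suc n))"
proof -
  obtain \<phi> T where \<phi>: "orthonormal_basis \<phi>" and T: "bounded_clinear T" "bij T"
      and iT: "bounded_clinear (inv T)" and e: "\<And>n. n \<ge> 1 \<Longrightarrow> e n = T (\<phi> n)"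
    using assms unfolding riesz_basis_def by blast
  from T(1) have bl: "bounded_linear T" and TC: "\<And>a x. T (a *\<^sub>C x) = a *\<^sub>C T x"
    by (auto simp: bounded_clinear_def)
  obtain P where P: "P \<ge> 0" "\<And>x. norm (T x) \<le> norm x * P"
    using bounded_linear.nonneg_bounded[OF bl] by blast
  obtain Q where Q: "Q \<ge> 0" "\<And>x. norm (inv T x) \<le> norm x * Q"
    using bounded_linear.nonneg_bounded[of "inv T"] iT unfolding bounded_clinear_def by blast
  have eq: "(\<Sum>n. a (Suc n) *\<^sub>C e (Suc n)) = T (\<Sum>n. a (Suc n) *\<^sub>C \<phi> (Suc n))"
    if "summable (\<lambda>n. (cmod (a (Suc n)))\<^sup>2)" for a
    using bounded_linear.suminf[OF bl orthonormal_series(1)[OF \<phi> that]] by (simp add: e TC)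
  show ?thesis
  proof (rule that[OF P(1) Q(1)])
    fix a :: "nat \<Rightarrow> complex" assume a: "summable (\<lambda>n. (cmod (a (Suc n)))\<^sup>2)"
    let ?x = "\<Sum>n. a (Suc n) *\<^sub>C \<phi> (Suc n)"
    show "norm (\<Sum>n. a (Suc n) *\<^sub>C e (Suc n)) \<le> P * l2_nrm a"
      using P(2)[of ?x] by (simp add: eq[OF a] orthonormal_series(2)[OF \<phi> a] mult.commute)
    show "l2_nrm a \<le> Q * norm (\<Sum>n. a (Suc n) *\<^sub>C e (Suc n))"
      using Q(2)[of "T ?x"] \<open>bij T\<close>
      by (simp add: eq[OF a] orthonormal_series(2)[OF \<phi> a] mult.commute bij_is_inj)
  qed
qed

section \<open>The resolvent\<close>

lemma l2_diff_add: "u \<in> l2_diff k \<Longrightarrow> v \<in> l2_diff k \<Longrightarrow> u + v \<in> l2_diff k"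
proof -
  assume u: "u \<in> l2_diff k" and v: "v \<in> l2_diff k"
  have "l2_part N ((bdiff ^^ k) (u + v)) \<le> l2_nrm ((bdiff ^^ k) u) + l2_nrm ((bdiff ^^ k) v)" for N
    using u v l2_part_add[of N "(bdiff ^^ k) u" "(bdiff ^^ k) v"]
      l2_part_le_l2_nrm[of "(bdiff ^^ k) u" N] l2_part_le_l2_nrm[of "(bdiff ^^ k) v" N]
    by (simp add: l2_diff_def bdiff_pow_add)
  from l2_bounded_partial(1)[OF this] u v show ?thesis by (simp add: l2_diff_def)
qed

lemma l2_diff_scale: "u \<in> l2_diff k \<Longrightarrow> (\<lambda>n. a * u n) \<in> l2_diff k"
  by (simp add: l2_diff_def bdiff_pow_scale norm_mult power_mult_distrib summable_mult)

lemma l2_diff_finite_support: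
  assumes "u 0 = 0" "\<And>n. n > M \<Longrightarrow> u n = 0"
  shows "u \<in> l2_diff k"
proof -
  have "(bdiff ^^ k) u (Suc n) = 0" if "n \<notin> {..M + k}" for n
    using bdiff_pow_eq_0[of M u k "Suc n"] assms(2) that by simp
  then have "summable (\<lambda>n. (cmod ((bdiff ^^ k) u (Suc n)))\<^sup>2)"
    by (intro summable_finite[of "{..M + k}"]) auto
  with assms(1) show ?thesis by (simp add: l2_diff_def)
qed

text \<open>The section estimates, uniform in N, give membership and an l2 bound on the k-th
  differences; the two Riesz basis inequalities transfer it to \<open>Hk_norm\<close>.\<close>

lemma Hk_multiplier_bounded:
  fixes e :: "nat \<Rightarrow> 'h::complex_hilbert"
  assumes e: "riesz_basis e" and g: "diff_decay k 0 g"
  obtains C where "\<And>c. c \<in> l2_diff k \<Longrightarrow> g * c \<in> l2_diff k"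
    and "\<And>c. c \<in> l2_diff k \<Longrightarrow> Hk_norm e k (g * c) \<le> C * Hk_norm e k c"
proof -
  obtain K where K: "\<And>c N. l2_part N ((bdiff ^^ k) (g * c)) \<le> K * l2_part N ((bdiff ^^ k) c)"
    using diff_decay_multiplier[OF g] by auto
  have part: "l2_part N ((bdiff ^^ k) (g * c)) \<le> \<bar>K\<bar> * l2_nrm ((bdiff ^^ k) c)"
    if "c \<in> l2_diff k" for c N
  proof -
    have "K * l2_part N ((bdiff ^^ k) c) \<le> \<bar>K\<bar> * l2_nrm ((bdiff ^^ k) c)"
      using that by (intro mult_mono l2_part_le_l2_nrm l2_part_nonneg) (auto simp: l2_diff_def)
    with K[of N c] show ?thesis by linarith
  qed
  have mem: "g * c \<in> l2_diff k" if "c \<in> l2_diff k" for c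
    using l2_bounded_partial(1)[OF part[OF that]] that by (simp add: l2_diff_def)
  obtain P Q where P: "P \<ge> 0" and Q: "Q \<ge> 0"
    and up: "\<And>a. summable (\<lambda>n. (cmod (a (Suc n)))\<^sup>2) \<Longrightarrow>
        norm (\<Sum>n. a (Suc n) *\<^sub>C e (Suc n)) \<le> P * l2_nrm a"
    and lo: "\<And>a. summable (\<lambda>n. (cmod (a (Suc n)))\<^sup>2) \<Longrightarrow>
        l2_nrm a \<le> Q * norm (\<Sum>n. a (Suc n) *\<^sub>C e (Suc n))"
    using riesz_basis_norm_equiv[OF e] by blast
  have "Hk_norm e k (g * c) \<le> (P * \<bar>K\<bar> * Q) * Hk_norm e k c" if c: "c \<in> l2_diff k" for c
  proof -
    have "Hk_norm e k (g * c) \<le> P * l2_nrm ((bdiff ^^ k) (g * c))"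
      unfolding Hk_norm_def using mem[OF c] by (intro up) (simp add: l2_diff_def)
    also have "\<dots> \<le> P * (\<bar>K\<bar> * l2_nrm ((bdiff ^^ k) c))"
      by (intro mult_left_mono l2_bounded_partial(2) part c P)
    also have "\<dots> \<le> P * (\<bar>K\<bar> * (Q * Hk_norm e k c))"
      unfolding Hk_norm_def using c by (intro mult_left_mono lo P) (auto simp: l2_diff_def)
    finally show ?thesis by (simp add: mult.assoc)
  qed
  with mem that show ?thesis by blast
qed

text \<open>The operator is diagonal: any nonzero coordinate of an eigenvector determines the
  eigenvalue, and unit sequences are eigenvectors.\<close>

lemma point_spectrum_A_op:
  "point_spectrum (A_dom k f) (A_op f) = {\<i> * complex_of_real (f n) |n. n \<ge> 1}"
proof (intro equalityI subsetI)
  fix \<mu> assume "\<mu> \<in> point_spectrum (A_dom k f) (A_op f)"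
  then obtain x where x: "x \<in> A_dom k f" "x \<noteq> 0" "A_op f x = \<mu> *\<^sub>C x"
    unfolding point_spectrum_def by blast
  obtain n where n: "x n \<noteq> 0" using x(2) by (auto simp: fun_eq_iff)
  \<comment> \<open>Elements of the space vanish at 0, so a nonzero coordinate has positive
    index.\<close>
  with x(1) have "n \<ge> 1" by (cases n) (auto simp: A_dom_def l2_diff_def)
  moreover from fun_cong[OF x(3), of n] n have "\<mu> = \<i> * complex_of_real (f n)"
    by (simp add: A_op_def scaleC_fun_def scaleC_complex_def)
  ultimately show "\<mu> \<in> {\<i> * complex_of_real (f n) |n. n \<ge> 1}" by blast
next
  fix \<mu> assume "\<mu> \<in> {\<i> * complex_of_real (f n) |n. n \<ge> 1}"
  then obtain n where n: "n \<ge> 1" "\<mu> = \<i> * complex_of_real (f n)" by blast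
  let ?x = "\<lambda>m. if m = n then 1 else 0 :: complex"
  have "?x \<in> A_dom k f"
    unfolding A_dom_def using n by (auto intro!: l2_diff_finite_support[of _ n])
  moreover have "?x \<noteq> 0" by (auto simp: fun_eq_iff)
  moreover have "A_op f ?x = \<mu> *\<^sub>C ?x"
    by (auto simp: A_op_def scaleC_fun_def scaleC_complex_def n)
  ultimately show "\<mu> \<in> point_spectrum (A_dom k f) (A_op f)"
    unfolding point_spectrum_def by blast
qed

text \<open>An eigenvector and 0 would have the same image under A - mu, against
  injectivity.\<close>

lemma resolvent_set_disjoint_point_spectrum:
  assumes "\<mu> \<in> resolvent_set X N D A" "0 \<in> D" "A 0 = 0"
  shows "\<mu> \<notin> point_spectrum D A"
proof
  assume "\<mu> \<in> point_spectrum D A"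
  then obtain x where x: "x \<in> D" "x \<noteq> 0" "A x = \<mu> *\<^sub>C x"
    unfolding point_spectrum_def by blast
  from assms have "inj_on (\<lambda>x. A x - \<mu> *\<^sub>C x) D"
    by (simp add: resolvent_set_def bij_betw_def)
  from inj_onD[OF this, of x 0] x assms show False by simp
qed

lemma A_op_resolvent:
  fixes e :: "nat \<Rightarrow> 'h::complex_hilbert"
  assumes e: "riesz_basis e" and f: "f \<in> S_class k"
    and \<mu>: "\<And>n. n \<ge> 1 \<Longrightarrow> \<i> * complex_of_real (f n) \<noteq> \<mu>"
  shows "\<mu> \<in> resolvent_set (l2_diff k) (Hk_norm e k) (A_dom k f) (A_op f)"
    and "c \<in> l2_diff k \<Longrightarrow>
      resolvent (A_dom k f) (A_op f) \<mu> c = (\<lambda>n. c n / (\<i> * complex_of_real (f n) - \<mu>))"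
proof -
  let ?g = "\<lambda>n. 1 / (\<i> * complex_of_real (f n) - \<mu>)"
  let ?B = "\<lambda>x. A_op f x - \<mu> *\<^sub>C x"
  have g: "diff_decay k 0 ?g" by (rule diff_decay_resolvent[OF f order_refl \<mu>])
  obtain C where mem: "\<And>c. c \<in> l2_diff k \<Longrightarrow> ?g * c \<in> l2_diff k"
    and bd: "\<And>c. c \<in> l2_diff k \<Longrightarrow> Hk_norm e k (?g * c) \<le> C * Hk_norm e k c"
    using Hk_multiplier_bounded[OF e g] by blast
  have B: "?B x = (\<lambda>n. (\<i> * complex_of_real (f n) - \<mu>) * x n)" for x
    by (simp add: A_op_def scaleC_fun_def scaleC_complex_def fun_eq_iff algebra_simps)
  have Bg: "?B (?g * c) = c" if "c \<in> l2_diff k" for c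
  proof
    fix n show "?B (?g * c) n = c n"
      \<comment> \<open>At n = 0, where if(0) = mu may happen, both sides vanish by the
        normalisation of c.\<close>
      unfolding B using that \<mu>[of n] by (cases "n = 0") (auto simp: l2_diff_def)
  qed
  have gB: "?g * ?B x = x" if "x \<in> A_dom k f" for x
  proof
    fix n show "(?g * ?B x) n = x n"
      unfolding B using that \<mu>[of n] by (cases "n = 0") (auto simp: A_dom_def l2_diff_def)
  qed
  have dom: "?g * c \<in> A_dom k f" if c: "c \<in> l2_diff k" for c
  proof -
    \<comment> \<open>As f is unbounded, membership of f g c is not a multiplier statement. Solving
      (if - mu) g c = c for f g c writes it as a combination of c and g c, both in the
      space.\<close>
    have "(\<lambda>n. complex_of_real (f n) * (?g * c) n)
        = (\<lambda>n. - \<i> * c n) + (\<lambda>n. (- \<i> * \<mu>) * (?g * c) n)"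
    proof
      fix n
      have "(\<i> * complex_of_real (f n) - \<mu>) * (?g * c) n = c n"
        using fun_cong[OF Bg[OF c], of n] unfolding B .
      then have eq: "\<i> * complex_of_real (f n) * (?g * c) n = c n + \<mu> * (?g * c) n"
        by (simp only: left_diff_distrib diff_eq_eq)
      have "complex_of_real (f n) * (?g * c) n
          = - \<i> * (\<i> * complex_of_real (f n) * (?g * c) n)"
        by (simp only: mult.assoc[symmetric]) simp
      also have "\<dots> = - \<i> * c n + (- \<i> * \<mu>) * (?g * c) n"
        unfolding eq by (simp only: distrib_left mult.assoc)
      finally show "complex_of_real (f n) * (?g * c) n
          = ((\<lambda>n. - \<i> * c n) + (\<lambda>n. (- \<i> * \<mu>) * (?g * c) n)) n"
        by simp
    qed
    also have "\<dots> \<in> l2_diff k"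
      by (intro l2_diff_add l2_diff_scale mem c)
    finally show ?thesis unfolding A_dom_def using mem[OF c] by blast
  qed
  have ran: "?B x \<in> l2_diff k" if "x \<in> A_dom k f" for x
  proof -
    \<comment> \<open>The domain condition puts both x and f x in the space.\<close>
    have "?B x = (\<lambda>n. \<i> * (complex_of_real (f n) * x n)) + (\<lambda>n. (- \<mu>) * x n)"
      unfolding B by (simp add: fun_eq_iff algebra_simps)
    also have "\<dots> \<in> l2_diff k"
      using that unfolding A_dom_def by (intro l2_diff_add l2_diff_scale) auto
    finally show ?thesis .
  qed
  have bij: "bij_betw ?B (A_dom k f) (l2_diff k)"
    by (rule bij_betwI[where g = "\<lambda>c. ?g * c"]) (auto intro: ran dom gB Bg)
  have res: "resolvent (A_dom k f) (A_op f) \<mu> c = ?g * c" if "c \<in> l2_diff k" for c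
    unfolding resolvent_def
    by (rule inv_into_f_eq[OF bij_betw_imp_inj_on[OF bij] dom[OF that]]) (rule Bg[OF that])
  show "\<mu> \<in> resolvent_set (l2_diff k) (Hk_norm e k) (A_dom k f) (A_op f)"
    unfolding resolvent_set_def using bij bd by (auto simp: res)
  show "c \<in> l2_diff k \<Longrightarrow>
      resolvent (A_dom k f) (A_op f) \<mu> c = (\<lambda>n. c n / (\<i> * complex_of_real (f n) - \<mu>))"
    by (simp add: res fun_eq_iff)
qed

theorem theorem3p1:
  fixes e :: "nat \<Rightarrow> 'h::complex_hilbert" and f :: "nat \<Rightarrow> real" and k :: nat
  assumes "riesz_basis e" and "k \<ge> 1" and "f \<in> S_class k"
  shows "spectrum (l2_diff k) (Hk_norm e k) (A_dom k f) (A_op f)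
           = point_spectrum (A_dom k f) (A_op f)
       \<and> point_spectrum (A_dom k f) (A_op f) = {\<i> * complex_of_real (f n) |n. n \<ge> 1}
       \<and> resolvent_set (l2_diff k) (Hk_norm e k) (A_dom k f) (A_op f)
           = UNIV - {\<i> * complex_of_real (f n) |n. n \<ge> 1}
       \<and> (\<forall>\<mu>\<in>resolvent_set (l2_diff k) (Hk_norm e k) (A_dom k f) (A_op f). \<forall>c\<in>l2_diff k.
            resolvent (A_dom k f) (A_op f) \<mu> c
              = (\<lambda>n. c n / (\<i> * complex_of_real (f n) - \<mu>)))"
proof -
  let ?\<Lambda> = "{\<i> * complex_of_real (f n) |n. n \<ge> 1}"
  let ?\<rho> = "resolvent_set (l2_diff k) (Hk_norm e k) (A_dom k f) (A_op f)"
  have 0: "(0 :: nat \<Rightarrow> complex) \<in> A_dom k f" "A_op f 0 = 0"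
    by (auto simp: A_dom_def A_op_def fun_eq_iff intro!: l2_diff_finite_support)
  have \<mu>: "\<i> * complex_of_real (f n) \<noteq> \<mu>" if "\<mu> \<notin> ?\<Lambda>" "n \<ge> 1" for \<mu> n
    using that by blast
  \<comment> \<open>Points of \<open>?\<Lambda>\<close> are eigenvalues and so lie outside the
    resolvent set; at all other points the multiplier gives a bounded inverse.\<close>
  have \<rho>: "?\<rho> = UNIV - ?\<Lambda>"
    using resolvent_set_disjoint_point_spectrum[of _ "l2_diff k" "Hk_norm e k" "A_dom k f" "A_op f", OF _ 0]
      A_op_resolvent(1)[OF assms(1,3) \<mu>]
    unfolding point_spectrum_A_op by blast
  moreover have "spectrum (l2_diff k) (Hk_norm e k) (A_dom k f) (A_op f) = ?\<Lambda>"
    unfolding spectrum_def \<rho> by blast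
  moreover have "resolvent (A_dom k f) (A_op f) \<mu> c = (\<lambda>n. c n / (\<i> * complex_of_real (f n) - \<mu>))"
    if "\<mu> \<in> ?\<rho>" "c \<in> l2_diff k" for \<mu> c
    using that \<mu> unfolding \<rho> by (intro A_op_resolvent(2)[OF assms(1,3)]) auto
  ultimately show ?thesis
    unfolding point_spectrum_A_op by blast
qed

end
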